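(* Let $p>2$ be a prime, let $g=g(x)\in\mathbb{F}_2[x]$ be an irreducible factor of $x^{2p}-1$, and let $f=g$ or $f=g^2$. For a divisor $h$ of $x^N-1$ let $\mathcal{C}_{N,h}$ denote the binary cyclic code of length $N$ with generator polynomial $h$. Then the full automorphism group $\mathrm{Aut}\,\mathcal{C}_{2p,f}$ is isomorphic to one of the following: (1) $\mathrm{S}_{2p}$, with $f=x+1$; or (2) $(\mathrm{S}_2)^p : \mathrm{Aut}\,\mathcal{C}_{p,f}$, with $f$ irreducible and not equal to $x+1$; or (3) $(\mathrm{Aut}\,\mathcal{C}_{p,g}\times \mathrm{Aut}\,\mathcal{C}_{p,g}).C_2$, with $f=g^2$ and $g$ irreducible. (Each group is the one that occurs under the condition on $f$ stated with it.)
   Context: All polynomials are over $\mathbb{F}_2$. Since $x^{2p}-1=(x^p-1)^2$, the irreducible factors of $x^{2p}-1$ are those of $x^p-1$, each occurring with multiplicity $2$. For $h(x)\in\mathbb{F}_2[x]$ dividing $x^N-1$, the binary cyclic code of length $N$ with generator polynomial $h$ is the set of all $(c_0,\dots,c_{N-1})\in\mathbb{F}_2^N$ such that $c_0+c_1x+\cdots+c_{N-1}x^{N-1}$ lies in the ideal generated by $h$ in $\mathbb{F}_2[x]/(x^N-1)$. For a code $\mathcal{C}$ of length $N$, an automorphism of $\mathcal{C}$ is a permutation of the $N$ coordinate positions that maps each codeword of $\mathcal{C}$ to a codeword of $\mathcal{C}$; the full automorphism group $\mathrm{Aut}\,\mathcal{C}\leqslant \mathrm{S}_N$ is the group of all of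 these under composition. $\mathrm{S}_N$ is the symmetric group of degree $N$, $(\mathrm{S}_2)^p$ is the direct product of $p$ copies of $\mathrm{S}_2$, and $C_2$ is the cyclic group of order $2$. $A:B$ denotes a semidirect product (split extension) with normal subgroup $A$ and complement $B$; $A.B$ denotes an extension, i.e. a group with a normal subgroup isomorphic to $A$ and corresponding quotient isomorphic to $B$. *)

theory Defs
  imports
    "HOL-Library.Z2"
    "HOL-Computational_Algebra.Polynomial_Factorial"
    "HOL-Number_Theory.Cong"
    "HOL-Combinatorics.Permutations"
    "HOL-Algebra.Sym_Groups"
    "HOL-Algebra.Product_Groups"
begin

text \<open>
  Binary words \<open>(c\<^sub>0, \<dots>, c\<^sub>N\<^sub>-\<^sub>1)\<close> are lists over the two-element field \<^typ>\<open>bit\<close>.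
  Membership of the class of \<open>c\<^sub>0 + c\<^sub>1 x + \<dots>\<close> in the ideal generated by \<open>h\<close> in the quotient
  ring modulo \<open>x\<^sup>N - 1\<close> is written out as a congruence of polynomials.
\<close>

definition cyclic_code :: "nat \<Rightarrow> bit poly \<Rightarrow> bit list set" where
  "cyclic_code N h =
     {c. length c = N \<and> (\<exists>q. [Poly c = h * q] (mod (monom 1 N - 1)))}"

text \<open>
  \<^term>\<open>permute_list \<pi> c\<close> has entry \<open>c\<^bsub>\<pi> i\<^esub>\<close> at position \<open>i\<close>, i.e. it moves coordinate
  \<open>\<pi> i\<close> to position \<open>i\<close>.  The opposite convention (coordinate \<open>i\<close> moves to position \<open>\<pi> i\<close>)
  yields the same set of permutations, since a code in \<open>bit\<^sup>N\<close> is finite and so the set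
  is closed under inverses.
\<close>

definition code_aut :: "nat \<Rightarrow> bit list set \<Rightarrow> (nat \<Rightarrow> nat) monoid" where
  "code_aut N C =
     \<lparr>carrier = {\<pi>. \<pi> permutes {..<N} \<and> (\<forall>c\<in>C. permute_list \<pi> c \<in> C)},
      mult = (\<circ>), one = id\<rparr>"

text \<open>\<open>G\<close> is, up to isomorphism, an extension \<open>A.B\<close> with normal subgroup \<open>A\<close> and quotient \<open>B\<close>.\<close>

definition is_extension ::
    "('g, 'x) monoid_scheme \<Rightarrow> ('a, 'y) monoid_scheme \<Rightarrow> ('b, 'z) monoid_scheme \<Rightarrow> bool" where
  "is_extension G A B \<longleftrightarrow>
     (\<exists>K. K \<lhd> G \<and> G\<lparr>carrier := K\<rparr> \<cong> A \<and> G Mod K \<cong> B)"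

text \<open>\<open>G\<close> is, up to isomorphism, a split extension \<open>A : B\<close>; the action of \<open>B\<close> on \<open>A\<close> is left open.\<close>

definition is_split_extension ::
    "('g, 'x) monoid_scheme \<Rightarrow> ('a, 'y) monoid_scheme \<Rightarrow> ('b, 'z) monoid_scheme \<Rightarrow> bool" where
  "is_split_extension G A B \<longleftrightarrow>
     (\<exists>K H. K \<lhd> G \<and> subgroup H G \<and> K \<inter> H = {\<one>\<^bsub>G\<^esub>} \<and> K <#>\<^bsub>G\<^esub> H = carrier G \<and>
            G\<lparr>carrier := K\<rparr> \<cong> A \<and> G\<lparr>carrier := H\<rparr> \<cong> B)"

end

theory Submission
  imports Defs
begin

text \<open>
  If \<open>f\<close> is irreducible and different from \<open>x + 1\<close>, then \<open>x\<close> has order \<open>p\<close> modulo \<open>f\<close>.  Hence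
  membership of \<open>c\<close> in \<open>C\<^bsub>2p,f\<^esub>\<close> depends only on the word \<open>c\<^sub>i + c\<^bsub>i+p\<^esub>\<close>,
  which has to lie in \<open>C\<^bsub>p,f\<^esub>\<close>, and the words of weight two in \<open>C\<^bsub>2p,f\<^esub>\<close> are exactly those supported on a pair \<open>{i, i + p}\<close>.  Automorphisms
  therefore permute these pairs; the kernel of this action consists of all products of swaps.

  For \<open>f = g\<^sup>2\<close> write \<open>c = A\<^sup>2 + x B\<^sup>2\<close>, where \<open>A\<close> and \<open>B\<close> collect the entries at even and at odd
  positions.  Since \<open>c' = B\<^sup>2\<close>, the code \<open>C\<^bsub>2p,f\<^esub>\<close> is the direct sum of two copies of \<open>C\<^bsub>p,g\<^esub>\<close>.  This
  summand is indecomposable: a minimal nonempty set of coordinates that splits it off meets each of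
  its cyclic shifts in itself or not at all, so, \<open>p\<close> being prime, it is a single point or everything,
  and a single point would give a word of weight one.  Hence an automorphism preserves or swaps the
  even and the odd positions.
\<close>

section \<open>Automorphisms of sets of words\<close>

text \<open>
  Words of length \<open>N\<close> are handled as functions on \<open>nat\<close> whose values from \<open>N\<close> on are irrelevant, so
  that permuting the coordinates is composition.
\<close>

definition word_poly :: "nat \<Rightarrow> (nat \<Rightarrow> bit) \<Rightarrow> bit poly" where
  "word_poly N w = (\<Sum>i<N. monom (w i) i)"

text \<open>Only closure under composition with \<pi> is demanded, as in \<open>code_aut\<close>;
  since \<pi> has finite order, this still yields a group.\<close>

definition word_aut :: "nat \<Rightarrow> ((nat \<Rightarrow> bit) \<Rightarrow> bool) \<Rightarrow> (nat \<Rightarrow> nat) monoid" where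
  "word_aut N P = \<lparr>carrier = {\<pi>. \<pi> permutes {..<N} \<and> (\<forall>w. P w \<longrightarrow> P (w \<circ> \<pi>))},
     mult = (\<circ>), one = id\<rparr>"

lemma word_aut_simps [simp]:
  "mult (word_aut N P) = (\<circ>)" "one (word_aut N P) = id"
  "\<pi> \<in> carrier (word_aut N P) \<longleftrightarrow> \<pi> permutes {..<N} \<and> (\<forall>w. P w \<longrightarrow> P (w \<circ> \<pi>))"
  by (simp_all add: word_aut_def)

lemma word_poly_cong: "(\<And>i. i < N \<Longrightarrow> u i = v i) \<Longrightarrow> word_poly N u = word_poly N v"
  by (simp add: word_poly_def)

lemma Poly_eq_word_poly: "Poly c = word_poly (length c) ((!) c)"
proof -
  have "coeff (word_poly (length c) ((!) c)) k = coeff (Poly c) k" for k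
    by (simp add: word_poly_def coeff_sum nth_default_def)
  then show ?thesis
    by (simp add: poly_eq_iff)
qed

lemma mem_cyclic_code_iff:
  assumes "h dvd monom 1 N - 1"
  shows "c \<in> cyclic_code N h \<longleftrightarrow> length c = N \<and> h dvd word_poly N ((!) c)"
proof -
  have "(\<exists>q. [Poly c = h * q] (mod (monom 1 N - 1))) \<longleftrightarrow> h dvd Poly c"
  proof
    assume "\<exists>q. [Poly c = h * q] (mod (monom 1 N - 1))"
    then obtain q where "monom 1 N - 1 dvd Poly c - h * q"
      by (auto simp: cong_iff_dvd_diff)
    then have "h dvd Poly c - h * q"
      using assms by (rule dvd_trans[rotated])
    then show "h dvd Poly c"
      by (simp add: dvd_diff_left_iff)
  next
    assume "h dvd Poly c"
    then obtain q where "Poly c = h * q" ..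
    then show "\<exists>q. [Poly c = h * q] (mod (monom 1 N - 1))"
      by (metis cong_refl)
  qed
  then show ?thesis
    by (auto simp: cyclic_code_def Poly_eq_word_poly)
qed

text \<open>Lists and functions impose the same condition: entries from N on do not enter
  \<open>word_poly N\<close>, and a permutation of \<open>{..<N}\<close> keeps indices below
  N.\<close>

lemma code_aut_cyclic_code:
  assumes "h dvd monom 1 N - 1"
  shows "code_aut N (cyclic_code N h) = word_aut N (\<lambda>w. h dvd word_poly N w)"
proof -
  have "(\<forall>c\<in>cyclic_code N h. permute_list \<pi> c \<in> cyclic_code N h) \<longleftrightarrow>
        (\<forall>w. h dvd word_poly N w \<longrightarrow> h dvd word_poly N (w \<circ> \<pi>))" (is "?L \<longleftrightarrow> ?R")
    if \<pi>: "\<pi> permutes {..<N}" for \<pi>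
  proof
    assume L: ?L
    show ?R
    proof (intro allI impI)
      fix w assume w: "h dvd word_poly N w"
      let ?c = "map w [0..<N]"
      have "word_poly N ((!) ?c) = word_poly N w"
        by (rule word_poly_cong) simp
      then have "?c \<in> cyclic_code N h"
        using w by (simp add: mem_cyclic_code_iff[OF assms])
      then have "h dvd word_poly N ((!) (permute_list \<pi> ?c))"
        using L by (simp add: mem_cyclic_code_iff[OF assms])
      also have "word_poly N ((!) (permute_list \<pi> ?c)) = word_poly N (w \<circ> \<pi>)"
        using permutes_in_image[OF \<pi>]
        by (intro word_poly_cong) (simp add: permute_list_def)
      finally show "h dvd word_poly N (w \<circ> \<pi>)" .
    qed
  next
    assume R: ?R
    show ?L
    proof
      fix c assume "c \<in> cyclic_code N h"
      then have c: "length c = N" "h dvd word_poly N ((!) c)"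
        by (simp_all add: mem_cyclic_code_iff[OF assms])
      have "word_poly N ((!) (permute_list \<pi> c)) = word_poly N ((!) c \<circ> \<pi>)"
        using c(1) by (intro word_poly_cong) (simp add: permute_list_def)
      then show "permute_list \<pi> c \<in> cyclic_code N h"
        using c R by (simp add: mem_cyclic_code_iff[OF assms])
    qed
  qed
  then show ?thesis
    by (auto simp: code_aut_def word_aut_def)
qed

lemma permutes_if_inverse:
  assumes "\<And>x. x \<notin> S \<Longrightarrow> f x = x" and "f \<circ> g = id" and "g \<circ> f = id"
  shows "f permutes S"
  using o_bij[OF assms(3,2)] assms(1) by (auto simp: permutes_def bij_iff)

text \<open>A permutation of a finite set has some finite order m, so its inverse is its power m -
  1, which preserves P because \<pi> does.\<close>

lemma group_word_aut: "group (word_aut N P)"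
proof (rule groupI)
  fix \<pi> assume \<pi>: "\<pi> \<in> carrier (word_aut N P)"
  then have perm: "\<pi> permutes {..<N}"
    by simp
  have "permutation \<pi>"
    using perm permutation_permutes by blast
  then obtain m where m: "\<pi> ^^ m = id" "m > 0"
    using permutation_is_nilpotent by blast
  have "\<pi> ^^ k \<in> carrier (word_aut N P)" for k
  proof (induction k)
    case 0
    then show ?case by (simp add: permutes_id flip: id_def)
  next
    case (Suc k)
    have "P (w \<circ> (\<pi> \<circ> \<pi> ^^ k))" if "P w" for w
      using Suc \<pi> that by (simp add: o_assoc)
    moreover have "\<pi> \<circ> \<pi> ^^ k permutes {..<N}"
      using Suc \<pi> by (intro permutes_compose) simp_all
    ultimately show ?case
      by (simp add: comp_def)
  qed
  moreover have "(\<pi> ^^ (m - 1)) \<circ> \<pi> = id"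
    using m by (metis Suc_diff_1 funpow_Suc_right)
  ultimately show "\<exists>\<rho>\<in>carrier (word_aut N P). \<rho> \<otimes>\<^bsub>word_aut N P\<^esub> \<pi> = \<one>\<^bsub>word_aut N P\<^esub>"
    by (intro bexI[of _ "\<pi> ^^ (m - 1)"]) simp_all
qed (auto intro: permutes_compose permutes_id simp: o_assoc)

text \<open>Composing a word with the inverse function moves its entry at i to position \<pi> i;
  this allows words to be transported forward along \<pi>.\<close>

lemma inv_mem_word_aut:
  assumes "\<pi> \<in> carrier (word_aut N P)"
  shows "Hilbert_Choice.inv \<pi> \<in> carrier (word_aut N P)"
proof -
  interpret group "word_aut N P" by (rule group_word_aut)
  have \<pi>: "\<pi> permutes {..<N}"
    using assms by simp
  obtain \<rho> where \<rho>: "\<rho> \<in> carrier (word_aut N P)" "\<rho> \<circ> \<pi> = id"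
    using l_inv_ex[OF assms] by auto
  have "\<rho> = \<rho> \<circ> (\<pi> \<circ> Hilbert_Choice.inv \<pi>)"
    using permutes_inv_o(1)[OF \<pi>] by simp
  also have "\<dots> = Hilbert_Choice.inv \<pi>"
    using \<rho>(2) by (simp add: o_assoc)
  finally show ?thesis
    using \<rho>(1) by simp
qed

section \<open>Words determined by the sums of their two halves\<close>

lemma mod_eq_iff_less_double:
  fixes i j n :: nat
  assumes "i < 2 * n" and "j < n"
  shows "i mod n = j \<longleftrightarrow> i = j \<or> i = j + n"
  using assms by (cases "i < n") (auto simp: mod_if)

text \<open>By \<open>P_pair\<close>, a word of weight two satisfies Q only if its support is a pair
  {i, i + n}, so automorphisms permute these pairs. The action on pairs is a homomorphism onto the
  automorphisms of P; it splits by acting alike on both halves.\<close>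

lemma word_aut_split_extension:
  fixes P Q :: "(nat \<Rightarrow> bit) \<Rightarrow> bool"
  assumes P_cong: "\<And>u v. P u \<Longrightarrow> (\<And>i. i < n \<Longrightarrow> u i = v i) \<Longrightarrow> P v"
    and Q_iff: "\<And>w. Q w \<longleftrightarrow> P (\<lambda>i. w i + w (i + n))"
    and P_zero: "P (\<lambda>_. 0)"
    and P_pair: "\<And>i j. i < n \<Longrightarrow> j < n \<Longrightarrow> P (\<lambda>k. of_bool (k = i) + of_bool (k = j)) \<Longrightarrow> i = j"
  shows "is_split_extension (word_aut (2 * n) Q)
    (product_group {..<n} (\<lambda>_. sym_group 2)) (word_aut n P)"
proof -
  let ?G = "word_aut (2 * n) Q" and ?A = "word_aut n P"
  interpret G: group ?G by (rule group_word_aut)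
  interpret A: group ?A by (rule group_word_aut)
  have fold_unit: "of_bool (k = i) + of_bool (k + n = i) = (of_bool (k = i mod n) :: bit)"
    if "k < n" "i < 2 * n" for k i
    using mod_eq_iff_less_double[OF that(2,1)] that by auto
  \<comment> \<open>Words of weight two are written as sums of two unit words, so that i = j
    harmlessly gives the zero word.\<close>
  have Q_pair_iff: "Q (\<lambda>k. of_bool (k = i) + of_bool (k = j)) \<longleftrightarrow>
      P (\<lambda>k. of_bool (k = i mod n) + of_bool (k = j mod n))" (is "_ \<longleftrightarrow> P ?v")
    if "i < 2 * n" "j < 2 * n" for i j
  proof -
    let ?u = "\<lambda>k. (of_bool (k = i) + of_bool (k = j)) + (of_bool (k + n = i) + of_bool (k + n = j)) :: bit"
    have "?u k = ?v k" if "k < n" for k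
      unfolding fold_unit[OF that \<open>i < 2 * n\<close>, symmetric] fold_unit[OF that \<open>j < 2 * n\<close>, symmetric]
      by (simp only: ac_simps)
    then show ?thesis
      unfolding Q_iff by (auto intro: P_cong)
  qed
  have less: "\<pi> i < 2 * n" if "\<pi> \<in> carrier ?G" "i < 2 * n" for \<pi> i
    using that permutes_in_image[of \<pi> "{..<2 * n}" i] by simp
  \<comment> \<open>The word supported on i and j folds to zero and so satisfies Q. Its image is
    supported on \<pi> i and \<pi> j, which \<open>P_pair\<close> then forces into one pair.\<close>
  have blocks: "\<pi> i mod n = \<pi> j mod n"
    if \<pi>: "\<pi> \<in> carrier ?G" and ij: "i < 2 * n" "j < 2 * n" "i mod n = j mod n" for \<pi> i j
  proof -
    have perm: "\<pi> permutes {..<2 * n}"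
      using \<pi> by simp
    let ?w = "\<lambda>k. of_bool (k = i) + of_bool (k = j) :: bit"
    have "Q ?w"
      unfolding Q_pair_iff[OF ij(1,2)] using P_zero ij(3) by simp
    then have "Q (?w \<circ> Hilbert_Choice.inv \<pi>)"
      using inv_mem_word_aut[OF \<pi>] by simp
    moreover have "?w \<circ> Hilbert_Choice.inv \<pi> = (\<lambda>k. of_bool (k = \<pi> i) + of_bool (k = \<pi> j))"
      by (auto simp: fun_eq_iff permutes_inv_eq[OF perm])
    ultimately have "P (\<lambda>k. of_bool (k = \<pi> i mod n) + of_bool (k = \<pi> j mod n))"
      using Q_pair_iff[OF less[OF \<pi> ij(1)] less[OF \<pi> ij(2)]] by simp
    moreover have "n > 0"
      using ij by simp
    ultimately show ?thesis
      using P_pair by simp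
  qed
  \<comment> \<open>\<open>red\<close> is the action on the n pairs, represented by residues modulo
    n; \<open>lift\<close> lets a permutation of the pairs act in the same way on both
    halves.\<close>
  define red :: "(nat \<Rightarrow> nat) \<Rightarrow> nat \<Rightarrow> nat" where "red \<pi> i = (if i < n then \<pi> i mod n else i)" for \<pi> i
  define lift :: "(nat \<Rightarrow> nat) \<Rightarrow> nat \<Rightarrow> nat"
    where "lift \<sigma> j = (if j < n then \<sigma> j else if j < 2 * n then \<sigma> (j - n) + n else j)" for \<sigma> j
  have red_comp: "red (\<pi> \<circ> \<rho>) = red \<pi> \<circ> red \<rho>" if "\<pi> \<in> carrier ?G" "\<rho> \<in> carrier ?G" for \<pi> \<rho>
  proof
    fix i
    show "red (\<pi> \<circ> \<rho>) i = (red \<pi> \<circ> red \<rho>) i"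
    proof (cases "i < n")
      case True
      then have "\<rho> i < 2 * n" "\<rho> i mod n < 2 * n"
        using less[OF that(2)] by (simp_all add: less_le_trans[OF mod_less_divisor])
      then have "\<pi> (\<rho> i) mod n = \<pi> (\<rho> i mod n) mod n"
        by (intro blocks[OF that(1)]) simp_all
      then show ?thesis
        using True by (simp add: red_def)
    qed (simp add: red_def)
  qed
  have red_id: "red id = id"
    by (auto simp: red_def)
  \<comment> \<open>Two distinct numbers below 2n with equal residues differ by n, so a pair goes to
    a pair, in order or reversed.\<close>
  have halves: "(\<pi> i < n \<and> \<pi> (i + n) = \<pi> i + n) \<or> (\<pi> (i + n) < n \<and> \<pi> i = \<pi> (i + n) + n)"
    if \<pi>: "\<pi> \<in> carrier ?G" and i: "i < n" for \<pi> i
  proof -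
    have "\<pi> i mod n = \<pi> (i + n) mod n"
      using i by (intro blocks[OF \<pi>]) simp_all
    moreover have "\<pi> i \<noteq> \<pi> (i + n)"
      using permutes_inj[of \<pi>] \<pi> i by (auto simp: inj_eq)
    moreover have "\<pi> i < 2 * n" "\<pi> (i + n) < 2 * n"
      using less[OF \<pi>] i by simp_all
    ultimately show ?thesis
      by (auto simp: mod_if split: if_splits)
  qed
  have red_mem: "red \<pi> \<in> carrier ?A" if \<pi>: "\<pi> \<in> carrier ?G" for \<pi>
  proof -
    let ?\<rho> = "Hilbert_Choice.inv \<pi>"
    have perm: "\<pi> permutes {..<2 * n}"
      using \<pi> by simp
    have "red \<pi> \<circ> red ?\<rho> = id" "red ?\<rho> \<circ> red \<pi> = id"
      using \<pi> inv_mem_word_aut[OF \<pi>]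
      by (simp_all only: red_comp[symmetric] permutes_inv_o[OF perm] red_id)
    then have "red \<pi> permutes {..<n}"
      by (intro permutes_if_inverse) (simp_all add: red_def)
    moreover have "P (u \<circ> red \<pi>)" if "P u" for u
    proof -
      \<comment> \<open>Padding u with zeros on the second half makes it fold to itself. After
        \<pi>, each pair still carries just one entry of u, so the folded word is
        \<open>u \<circ> red \<pi>\<close>.\<close>
      let ?w = "\<lambda>i. if i < n then u i else 0"
      have "Q ?w"
        unfolding Q_iff using that by (auto elim: P_cong)
      then have "Q (?w \<circ> \<pi>)"
        using \<pi> by simp
      then have "P (\<lambda>i. ?w (\<pi> i) + ?w (\<pi> (i + n)))"
        by (simp only: Q_iff comp_def)
      then show ?thesis
      proof (rule P_cong)
        fix i assume "i < n"
        with halves[OF \<pi> this] show "?w (\<pi> i) + ?w (\<pi> (i + n)) = (u \<circ> red \<pi>) i"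
          by (auto simp: red_def)
      qed
    qed
    ultimately show ?thesis
      by simp
  qed
  have lift_comp: "lift (\<sigma> \<circ> \<tau>) = lift \<sigma> \<circ> lift \<tau>" if "\<tau> \<in> carrier ?A" for \<sigma> \<tau>
  proof
    fix j
    have "\<tau> k < n" if "k < n" for k
      using permutes_in_image[of \<tau> "{..<n}" k] \<open>\<tau> \<in> carrier ?A\<close> that by simp
    from this[of j] this[of "j - n"] show "lift (\<sigma> \<circ> \<tau>) j = (lift \<sigma> \<circ> lift \<tau>) j"
      by (auto simp: lift_def)
  qed
  have lift_id: "lift id = id"
    by (auto simp: lift_def)
  have lift_mem: "lift \<sigma> \<in> carrier ?G" if \<sigma>: "\<sigma> \<in> carrier ?A" for \<sigma>
  proof -
    have perm: "\<sigma> permutes {..<n}"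
      using \<sigma> by simp
    have "lift \<sigma> \<circ> lift (Hilbert_Choice.inv \<sigma>) = id" "lift (Hilbert_Choice.inv \<sigma>) \<circ> lift \<sigma> = id"
      using \<sigma> inv_mem_word_aut[OF \<sigma>]
      by (simp_all only: lift_comp[symmetric] permutes_inv_o[OF perm] lift_id)
    then have "lift \<sigma> permutes {..<2 * n}"
      by (intro permutes_if_inverse) (simp_all add: lift_def)
    moreover have "Q (w \<circ> lift \<sigma>)" if "Q w" for w
    proof -
      have "P ((\<lambda>i. w i + w (i + n)) \<circ> \<sigma>)"
        using that \<sigma> by (simp only: Q_iff word_aut_simps)
      then show ?thesis
        unfolding Q_iff by (rule P_cong) (simp add: lift_def)
    qed
    ultimately show ?thesis
      by simp
  qed
  have red_lift: "red (lift \<sigma>) = \<sigma>" if "\<sigma> \<in> carrier ?A" for \<sigma>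
    using that permutes_in_image[of \<sigma> "{..<n}"] permutes_not_in[of \<sigma> "{..<n}"]
    by (auto simp: fun_eq_iff red_def lift_def)
  interpret red: group_hom ?G ?A red
    by unfold_locales (auto simp: hom_def red_mem[simplified] red_comp)
  interpret lift: group_hom ?A ?G lift
    by unfold_locales (auto simp: hom_def lift_mem[simplified] lift_comp)
  let ?K = "kernel ?G ?A red" and ?H = "lift ` carrier ?A"
  have sub: "subgroup ?H ?G"
    by (rule lift.img_is_subgroup)
  have triv: "?K \<inter> ?H = {\<one>\<^bsub>?G\<^esub>}"
  proof
    show "?K \<inter> ?H \<subseteq> {\<one>\<^bsub>?G\<^esub>}"
      using red_lift lift_id by (auto simp: kernel_def simp del: word_aut_simps(3))
    show "{\<one>\<^bsub>?G\<^esub>} \<subseteq> ?K \<inter> ?H"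
      using subgroup.one_closed[OF red.subgroup_kernel] subgroup.one_closed[OF sub] by blast
  qed
  have gen: "?K <#>\<^bsub>?G\<^esub> ?H = carrier ?G"
  proof
    show "?K <#>\<^bsub>?G\<^esub> ?H \<subseteq> carrier ?G"
      using G.set_mult_closed subgroup.subset[OF sub] subgroup.subset[OF red.subgroup_kernel] by blast
    show "carrier ?G \<subseteq> ?K <#>\<^bsub>?G\<^esub> ?H"
    proof
      fix \<pi> assume \<pi>: "\<pi> \<in> carrier ?G"
      let ?l = "lift (red \<pi>)"
      have l: "?l \<in> carrier ?G"
        using lift_mem red_mem \<pi> by blast
      \<comment> \<open>Dividing \<pi> by the lift of its own image moves it into the kernel,
        because \<open>red\<close> undoes \<open>lift\<close>.\<close>
      let ?k = "\<pi> \<otimes>\<^bsub>?G\<^esub> inv\<^bsub>?G\<^esub> ?l"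
      have "red ?k = \<one>\<^bsub>?A\<^esub>"
        using \<pi> l red_mem[OF \<pi>] by (simp only: red.hom_mult G.inv_closed red.hom_inv red_lift A.r_inv)
      then have "?k \<in> ?K"
        using \<pi> l G.m_closed G.inv_closed by (simp only: kernel_def mem_Collect_eq)
      moreover have "?l \<in> ?H"
        using red_mem[OF \<pi>] by blast
      moreover have "?k \<otimes>\<^bsub>?G\<^esub> ?l = \<pi>"
        using \<pi> l by (simp only: G.m_assoc G.inv_closed G.l_inv G.r_one)
      ultimately show "\<pi> \<in> ?K <#>\<^bsub>?G\<^esub> ?H"
        unfolding set_mult_def by blast
    qed
  qed
  have isoH: "?G\<lparr>carrier := ?H\<rparr> \<cong> ?A"
  proof -
    have "red \<in> iso (?G\<lparr>carrier := ?H\<rparr>) ?A"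
    proof (rule isoI)
      show "red \<in> hom (?G\<lparr>carrier := ?H\<rparr>) ?A"
        using lift_mem red_mem red_comp
        by (auto simp: hom_def red_lift simp del: word_aut_simps(3))
      show "bij_betw red (carrier (?G\<lparr>carrier := ?H\<rparr>)) (carrier ?A)"
        by (rule bij_betwI[where g = lift]) (auto simp: red_lift simp del: word_aut_simps(3))
    qed
    then show ?thesis
      by (rule is_isoI)
  qed
  \<comment> \<open>Swapping inside pairs leaves each sum \<open>w i + w (i + n)\<close> unchanged,
    so every choice of swaps preserves Q.\<close>
  have K_iff: "k \<in> ?K \<longleftrightarrow> k permutes {..<2 * n} \<and>
      (\<forall>i<n. (k i = i \<and> k (i + n) = i + n) \<or> (k i = i + n \<and> k (i + n) = i))"
    (is "_ \<longleftrightarrow> ?R k") for k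
  proof
    assume k: "k \<in> ?K"
    then have kG: "k \<in> carrier ?G" and "red k = id"
      by (simp_all add: kernel_def)
    then have "k i mod n = i" if "i < n" for i
      using that by (metis red_def id_apply)
    moreover have "k permutes {..<2 * n}"
      using kG by simp
    ultimately show "?R k"
      using halves[OF kG] by (metis mod_add_self2 mod_less)
  next
    assume k: "?R k"
    have "Q (w \<circ> k)" if "Q w" for w
    proof -
      from that have "P (\<lambda>i. w i + w (i + n))"
        by (simp add: Q_iff)
      then show ?thesis
        unfolding Q_iff
      proof (rule P_cong)
        fix i assume "i < n"
        then show "w i + w (i + n) = (w \<circ> k) i + (w \<circ> k) (i + n)"
          using k by (metis add.commute comp_apply)
      qed
    qed
    moreover have "red k i = i" for i
      using k by (cases "i < n") (auto simp: red_def)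
    ultimately show "k \<in> ?K"
      using k by (auto simp: kernel_def)
  qed
  have isoK: "?G\<lparr>carrier := ?K\<rparr> \<cong> product_group {..<n} (\<lambda>_. sym_group 2)"
  proof -
    let ?t = "Transposition.transpose 1 2 :: nat \<Rightarrow> nat"
    have "{1..2} = {1, 2 :: nat}"
      by auto
    then have carr: "carrier (sym_group 2) = {id, ?t}"
      by (auto simp: sym_group_def permutes_doubleton_iff)
    have t: "?t \<noteq> id" "?t \<circ> ?t = id"
      by (auto simp: fun_eq_iff transpose_def)
    \<comment> \<open>\<phi> records for each pair whether it is swapped; the restricted abstraction
      matches the extensional functions in \<open>product_group\<close>.\<close>
    define \<phi> where "\<phi> k = (\<lambda>i\<in>{..<n}. if k i = i then id else ?t)" for k :: "nat \<Rightarrow> nat"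
    have "\<phi> \<in> iso (?G\<lparr>carrier := ?K\<rparr>) (product_group {..<n} (\<lambda>_. sym_group 2))"
    proof (rule isoI)
      show "\<phi> \<in> hom (?G\<lparr>carrier := ?K\<rparr>) (product_group {..<n} (\<lambda>_. sym_group 2))"
      proof (rule homI)
        fix k assume "k \<in> carrier (?G\<lparr>carrier := ?K\<rparr>)"
        show "\<phi> k \<in> carrier (product_group {..<n} (\<lambda>_. sym_group 2))"
          by (auto simp: \<phi>_def carr)
      next
        fix k l assume "k \<in> carrier (?G\<lparr>carrier := ?K\<rparr>)" "l \<in> carrier (?G\<lparr>carrier := ?K\<rparr>)"
        then have kl: "\<And>i. i < n \<Longrightarrow> (k i = i \<and> k (i + n) = i + n) \<or> (k i = i + n \<and> k (i + n) = i)"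
            "\<And>i. i < n \<Longrightarrow> (l i = i \<and> l (i + n) = i + n) \<or> (l i = i + n \<and> l (i + n) = i)"
          by (auto simp: K_iff)
        have "\<phi> (k \<circ> l) i = (\<lambda>i\<in>{..<n}. \<phi> k i \<circ> \<phi> l i) i" for i
          using kl[of i] t(2) by (cases "i < n") (auto simp: \<phi>_def)
        then show "\<phi> (k \<otimes>\<^bsub>?G\<lparr>carrier := ?K\<rparr>\<^esub> l) =
            \<phi> k \<otimes>\<^bsub>product_group {..<n} (\<lambda>_. sym_group 2)\<^esub> \<phi> l"
          by (simp add: product_group_def sym_group_def fun_eq_iff)
      qed
      show "bij_betw \<phi> (carrier (?G\<lparr>carrier := ?K\<rparr>)) (carrier (product_group {..<n} (\<lambda>_. sym_group 2)))"
        unfolding bij_betw_def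
      proof
        show "inj_on \<phi> (carrier (?G\<lparr>carrier := ?K\<rparr>))"
        proof (rule inj_onI)
          fix k l assume "k \<in> carrier (?G\<lparr>carrier := ?K\<rparr>)" "l \<in> carrier (?G\<lparr>carrier := ?K\<rparr>)"
            and eq: "\<phi> k = \<phi> l"
          then have kl: "?R k" "?R l"
            by (auto simp: K_iff)
          have fixed: "k i = i \<longleftrightarrow> l i = i" if "i < n" for i
            using fun_cong[OF eq, of i] that t(1) by (auto simp: \<phi>_def split: if_splits)
          have low: "k i = l i" "k (i + n) = l (i + n)" if "i < n" for i
            using fixed[OF that] kl that by metis+
          show "k = l"
          proof
            fix i
            consider "i < n" | "n \<le> i" "i < 2 * n" | "i \<notin> {..<2 * n}"
              by fastforce
            then show "k i = l i"
            proof cases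
              case 2
              then show ?thesis
                using low(2)[of "i - n"] by simp
            next
              case 3
              then show ?thesis
                using kl permutes_not_in by metis
            qed (rule low)
          qed
        qed
        have "s \<in> \<phi> ` ?K" if s: "s \<in> ({..<n} \<rightarrow>\<^sub>E {id, ?t})" for s
        proof
          \<comment> \<open>The preimage of s swaps exactly the pairs at which s is not the
            identity; being an involution, it is a permutation.\<close>
          define k where "k j = (if j < n then if s j = id then j else j + n
            else if j < 2 * n then if s (j - n) = id then j else j - n else j)" for j
          have "k \<circ> k = id"
            by (auto simp: k_def fun_eq_iff)
          then have "k permutes {..<2 * n}"
            by (intro permutes_if_inverse[where g = k]) (simp_all add: k_def)
          then show "k \<in> ?K"
            by (auto simp: K_iff k_def)
          show "s = \<phi> k"
          proof
            fix i
            show "s i = \<phi> k i"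
              using s PiE_mem[OF s, of i] PiE_arb[OF s, of i] by (auto simp: \<phi>_def k_def)
          qed
        qed
        moreover have "\<phi> k \<in> ({..<n} \<rightarrow>\<^sub>E {id, ?t})" for k
          by (auto simp: \<phi>_def)
        ultimately show "\<phi> ` carrier (?G\<lparr>carrier := ?K\<rparr>) = carrier (product_group {..<n} (\<lambda>_. sym_group 2))"
          by (auto simp: carr)
      qed
    qed
    then show ?thesis
      by (rule is_isoI)
  qed
  show ?thesis
    unfolding is_split_extension_def
    using red.normal_kernel sub triv gen isoK isoH by blast
qed

section \<open>Direct sums of two copies of an indecomposable code\<close>

text \<open>For a linear code this means that it is the direct sum of its words supported in S and
  its words vanishing on S.\<close>

definition separator :: "nat \<Rightarrow> ((nat \<Rightarrow> bit) \<Rightarrow> bool) \<Rightarrow> nat set \<Rightarrow> bool" where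
  "separator N P S \<longleftrightarrow> S \<subseteq> {..<N} \<and> (\<forall>w. P w \<longrightarrow> P (\<lambda>i. if i \<in> S then w i else 0))"

lemma separator_Int:
  assumes "separator N P S" and "separator N P T"
  shows "separator N P (S \<inter> T)"
proof -
  have "P (\<lambda>i. if i \<in> S \<inter> T then w i else 0)" if "P w" for w
  proof -
    have "P (\<lambda>i. if i \<in> S then (if i \<in> T then w i else 0) else 0)"
      using assms that by (simp add: separator_def)
    also have "(\<lambda>i. if i \<in> S then (if i \<in> T then w i else 0) else 0) = (\<lambda>i. if i \<in> S \<inter> T then w i else 0)"
      by auto
    finally show ?thesis .
  qed
  then show ?thesis
    using assms by (auto simp: separator_def)
qed

text \<open>A word is transported by the inverse of \<pi>, cut down to S and transported
  back.\<close>

lemma separator_vimage: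
  assumes "separator N P S" and \<pi>: "\<pi> \<in> carrier (word_aut N P)"
  shows "separator N P (\<pi> -` S)"
proof -
  have perm: "\<pi> permutes {..<N}"
    using \<pi> by simp
  have "P (\<lambda>i. if i \<in> \<pi> -` S then w i else 0)" if "P w" for w
  proof -
    have "P (w \<circ> Hilbert_Choice.inv \<pi>)"
      using inv_mem_word_aut[OF \<pi>] that by simp
    then have "P (\<lambda>i. if i \<in> S then (w \<circ> Hilbert_Choice.inv \<pi>) i else 0)"
      using assms(1) unfolding separator_def by blast
    then have "P ((\<lambda>i. if i \<in> S then (w \<circ> Hilbert_Choice.inv \<pi>) i else 0) \<circ> \<pi>)"
      using \<pi> unfolding word_aut_simps by blast
    also have "(\<lambda>i. if i \<in> S then (w \<circ> Hilbert_Choice.inv \<pi>) i else 0) \<circ> \<pi> =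
        (\<lambda>i. if i \<in> \<pi> -` S then w i else 0)"
      by (auto simp: permutes_inverses(2)[OF perm])
    finally show ?thesis .
  qed
  moreover have "\<pi> -` S \<subseteq> {..<N}"
    using assms(1) permutes_in_image[OF perm] by (auto simp: separator_def)
  ultimately show ?thesis
    by (simp add: separator_def)
qed

text \<open>Let T be a nonempty separator of least size. If it contains two points, minimality makes
  it invariant under the shift by their distance, which generates the integers modulo p. If it is a
  single point, cutting a shift of \<open>w0\<close> down to it gives a word excluded by
  \<open>no_unit\<close>.\<close>

lemma separator_cyclic_prime:
  fixes P :: "(nat \<Rightarrow> bit) \<Rightarrow> bool"
  assumes "prime p"
    and shift: "(\<lambda>i. if i < p then Suc i mod p else i) \<in> carrier (word_aut p P)"
    and P_cong: "\<And>u v. P u \<Longrightarrow> (\<And>i. i < p \<Longrightarrow> u i = v i) \<Longrightarrow> P v"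
    and w0: "P w0" "j0 < p" "w0 j0 = 1"
    and no_unit: "\<And>i. i < p \<Longrightarrow> \<not> P (\<lambda>k. of_bool (k = i))"
    and S: "separator p P S" "S \<noteq> {}"
  shows "S = {..<p}"
proof -
  define rot where "rot d i = (if i < p then (i + d) mod p else i)" for d i
  have p: "p > 0"
    using \<open>prime p\<close> prime_gt_0_nat by blast
  interpret group "word_aut p P" by (rule group_word_aut)
  have rot: "rot d \<in> carrier (word_aut p P)" for d
  proof (induction d)
    case 0
    have "rot 0 = \<one>\<^bsub>word_aut p P\<^esub>"
      by (auto simp: rot_def)
    then show ?case
      by (simp only: one_closed)
  next
    case (Suc d)
    have "rot (Suc d) = (\<lambda>i. if i < p then Suc i mod p else i) \<otimes>\<^bsub>word_aut p P\<^esub> rot d"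
      using p by (auto simp: rot_def mod_Suc_eq)
    then show ?case
      using m_closed[OF shift Suc] by (simp only:)
  qed
  obtain T where T: "separator p P T" "T \<noteq> {}"
    and min: "\<And>U. separator p P U \<Longrightarrow> U \<noteq> {} \<Longrightarrow> card T \<le> card U"
    using ex_has_least_nat[of "\<lambda>T. separator p P T \<and> T \<noteq> {}" S card] S by blast
  have sub: "T \<subseteq> {..<p}"
    using T(1) by (simp add: separator_def)
  then have fin: "finite T"
    using finite_subset by blast
  have "T = {..<p}"
  proof (cases "\<exists>i\<in>T. \<exists>j\<in>T. i < j")
    case True
    then obtain i j where ij: "i \<in> T" "j \<in> T" "i < j"
      by blast
    then have jp: "j < p"
      using sub by auto
    define d where "d = j - i"
    have d: "i + d = j" "0 < d" "d < p"
      using ij jp by (auto simp: d_def)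
    \<comment> \<open>The intersection contains i, as both i and i + d = j lie in T; by minimality
      it is all of T.\<close>
    have "separator p P (T \<inter> rot d -` T)"
      using T(1) rot by (intro separator_Int separator_vimage)
    moreover have "i \<in> T \<inter> rot d -` T"
      using ij d jp by (simp add: rot_def)
    ultimately have "card T \<le> card (T \<inter> rot d -` T)"
      by (intro min) auto
    then have "T \<inter> rot d -` T = T"
      using fin by (intro card_subset_eq) (auto intro: antisym card_mono)
    then have step: "(k + d) mod p \<in> T" if "k \<in> T" for k
    proof -
      have "k \<in> rot d -` T" "k < p"
        using that sub \<open>T \<inter> rot d -` T = T\<close> by blast+
      then show ?thesis
        by (simp add: rot_def)
    qed
    have orbit: "(i + m * d) mod p \<in> T" for m
    proof (induction m)
      case 0
      then show ?case using ij jp by simp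
    next
      case (Suc m)
      from step[OF Suc] show ?case
        unfolding mod_add_left_eq by (simp add: ac_simps)
    qed
    have "coprime p d"
      using prime_imp_coprime[OF \<open>prime p\<close>] nat_dvd_not_less[OF d(2,3)] by blast
    then obtain x where x: "[d * x = 1] (mod p)"
      using cong_solve_coprime_nat[of d p] by (auto simp: coprime_commute)
    have "k \<in> T" if "k < p" for k
    proof -
      \<comment> \<open>With x inverse to d modulo p, \<open>x * (k + (p - i))\<close> steps of
        length d lead from i to k; \<open>p - i\<close> stands for minus i, since k - i could be
        truncated.\<close>
      have "[i + d * x * (k + (p - i)) = i + 1 * (k + (p - i))] (mod p)"
        by (intro cong_add cong_mult x cong_refl)
      also have "i + 1 * (k + (p - i)) = k + p"
        using ij jp by simp
      finally have "(i + (x * (k + (p - i))) * d) mod p = k"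
        using that by (simp add: cong_def ac_simps)
      then show ?thesis
        using orbit by metis
    qed
    then show ?thesis
      using sub by auto
  next
    case False
    obtain a where a: "a \<in> T"
      using T(2) by blast
    then have "b = a" if "b \<in> T" for b
      using False that by (cases b a rule: linorder_cases) auto
    then have "T = {a}"
      using a by blast
    have ap: "a < p"
      using a sub by auto
    \<comment> \<open>The shift by \<open>j0 + (p - a)\<close> carries a to \<open>j0\<close>, where
      \<open>w0\<close> has a one.\<close>
    let ?w = "w0 \<circ> rot (j0 + (p - a))"
    have "P ?w"
      using rot[of "j0 + (p - a)"] w0(1) by simp
    then have "P (\<lambda>i. if i \<in> T then ?w i else 0)"
      using T(1) unfolding separator_def by blast
    moreover have "?w a = 1"
      using ap w0 by (simp add: rot_def)
    ultimately have "P (\<lambda>k. of_bool (k = a))"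
      by (elim P_cong) (use \<open>T = {a}\<close> in auto)
    then show ?thesis
      using no_unit ap by blast
  qed
  then have "p \<le> card S"
    using min[OF S] by simp
  moreover have "S \<subseteq> {..<p}"
    using S by (simp add: separator_def)
  ultimately show ?thesis
    by (intro card_subset_eq) (auto dest: card_mono[rotated])
qed

text \<open>Indecomposability forces an automorphism to send all even positions into one parity
  class. The parity of \<pi> 0 then gives a homomorphism onto the group of order two, whose kernel
  acts on the two classes independently.\<close>

lemma word_aut_extension:
  fixes P Q :: "(nat \<Rightarrow> bit) \<Rightarrow> bool"
  assumes "n > 0"
    and P_cong: "\<And>u v. P u \<Longrightarrow> (\<And>i. i < n \<Longrightarrow> u i = v i) \<Longrightarrow> P v"
    and Q_iff: "\<And>w. Q w \<longleftrightarrow> P (\<lambda>i. w (2 * i)) \<and> P (\<lambda>i. w (2 * i + 1))"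
    and P_zero: "P (\<lambda>_. 0)"
    and indecomposable: "\<And>S. separator n P S \<Longrightarrow> S \<noteq> {} \<Longrightarrow> S = {..<n}"
  shows "is_extension (word_aut (2 * n) Q) (word_aut n P \<times>\<times> word_aut n P) (integer_mod_group 2)"
proof -
  let ?G = "word_aut (2 * n) Q" and ?A = "word_aut n P" and ?C = "integer_mod_group 2"
  interpret G: group ?G by (rule group_word_aut)
  interpret A: group ?A by (rule group_word_aut)
  interpret C: group ?C by simp
  have less: "\<pi> i < 2 * n" if "\<pi> \<in> carrier ?G" "i < 2 * n" for \<pi> i
    using that permutes_in_image[of \<pi> "{..<2 * n}" i] by simp
  have sep_parity: "separator (2 * n) Q {i. i < 2 * n \<and> (even i \<longleftrightarrow> b)}" for b
  proof -
    have "Q (\<lambda>i. if i < 2 * n \<and> (even i \<longleftrightarrow> b) then w i else 0)" if "Q w" for w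
      using that P_zero unfolding Q_iff by (cases b) (auto elim: P_cong)
    then show ?thesis
      by (auto simp: separator_def)
  qed
  \<comment> \<open>Placing a word of P on the even positions, with zeros on the odd ones, turns a
    separator of Q into one of P.\<close>
  have sep_half: "separator n P {i. 2 * i \<in> S}" if S: "separator (2 * n) Q S" for S
  proof -
    have "P (\<lambda>i. if 2 * i \<in> S then u i else 0)" if "P u" for u
    proof -
      let ?w = "\<lambda>k. if even k then u (k div 2) else 0"
      have "Q ?w"
        using that P_zero by (simp add: Q_iff)
      then have "Q (\<lambda>k. if k \<in> S then ?w k else 0)"
        using S by (simp add: separator_def)
      then show ?thesis
        by (simp add: Q_iff cong: if_cong)
    qed
    then show ?thesis
      using S by (auto simp: separator_def)
  qed
  have even_block: "even (\<pi> (2 * i)) \<longleftrightarrow> even (\<pi> 0)" if \<pi>: "\<pi> \<in> carrier ?G" and i: "i < n" for \<pi> i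
  proof -
    \<comment> \<open>The preimage of the parity class of \<pi> 0 is a separator. Its even part
      contains 0, so by indecomposability it consists of all even positions.\<close>
    let ?S = "{i. 2 * i \<in> \<pi> -` {i. i < 2 * n \<and> (even i \<longleftrightarrow> even (\<pi> 0))}}"
    have "separator n P ?S"
      by (intro sep_half separator_vimage sep_parity \<pi>)
    moreover have "0 \<in> ?S"
      using less[OF \<pi>] \<open>n > 0\<close> by simp
    ultimately have "?S = {..<n}"
      using indecomposable by blast
    then have "i \<in> ?S"
      using i by simp
    then show ?thesis
      by simp
  qed
  have parity: "even (\<pi> k) \<longleftrightarrow> (even k \<longleftrightarrow> even (\<pi> 0))" if \<pi>: "\<pi> \<in> carrier ?G" and k: "k < 2 * n" for \<pi> k
  proof (cases "even k")
    case True
    then show ?thesis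
      using even_block[OF \<pi>, of "k div 2"] k by auto
  next
    case False
    have "even (\<pi> k) \<longleftrightarrow> odd (\<pi> 0)"
    proof (rule ccontr)
      assume "\<not> (even (\<pi> k) \<longleftrightarrow> odd (\<pi> 0))"
      then have eq: "even (\<pi> k) \<longleftrightarrow> even (\<pi> 0)"
        by blast
      \<comment> \<open>Counting: the n even positions together with k would be n + 1 points mapped
        injectively into a parity class of n points.\<close>
      let ?E = "(\<lambda>i. 2 * i) ` {..<n}" and ?c = "if even (\<pi> 0) then 0 else 1 :: nat"
      let ?X = "(\<lambda>i. 2 * i + ?c) ` {..<n}"
      have "\<pi> j \<in> ?X" if "j \<in> insert k ?E" for j
      proof -
        have "even (\<pi> j) \<longleftrightarrow> even (\<pi> 0)" "\<pi> j < 2 * n"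
          using that eq even_block[OF \<pi>] less[OF \<pi>] k by auto
        then show ?thesis
          by (intro image_eqI[of _ _ "\<pi> j div 2"]) auto
      qed
      moreover have "inj_on \<pi> (insert k ?E)"
        using \<pi> permutes_inj_on[of \<pi> "{..<2 * n}"] by (simp only: word_aut_simps)
      ultimately have "card (insert k ?E) \<le> card ?X"
        by (intro card_inj_on_le[of \<pi>]) auto
      also have "\<dots> \<le> n"
        using card_image_le[of "{..<n}" "\<lambda>i. 2 * i + ?c"] by simp
      finally have "card (insert k ?E) \<le> n" .
      moreover have "k \<notin> ?E"
        using False by auto
      moreover have "card ?E = n"
        by (simp add: card_image inj_on_def)
      ultimately show False
        by simp
    qed
    then show ?thesis
      using False by simp
  qed
  \<comment> \<open>By \<open>parity\<close>, the value at 0 alone decides whether \<pi> preserves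
    or exchanges the parity classes.\<close>
  define \<theta> :: "(nat \<Rightarrow> nat) \<Rightarrow> int" where "\<theta> \<pi> = (if even (\<pi> 0) then 0 else 1)" for \<pi>
  have \<theta>_hom: "\<theta> \<in> hom ?G ?C"
  proof (rule homI)
    fix \<pi> show "\<theta> \<pi> \<in> carrier ?C"
      by (simp add: \<theta>_def carrier_integer_mod_group)
  next
    fix \<pi> \<rho> assume \<pi>: "\<pi> \<in> carrier ?G" and \<rho>: "\<rho> \<in> carrier ?G"
    have "even (\<pi> (\<rho> 0)) \<longleftrightarrow> (even (\<rho> 0) \<longleftrightarrow> even (\<pi> 0))"
      using \<open>n > 0\<close> by (intro parity[OF \<pi>] less[OF \<rho>]) simp
    then show "\<theta> (\<pi> \<otimes>\<^bsub>?G\<^esub> \<rho>) = \<theta> \<pi> \<otimes>\<^bsub>?C\<^esub> \<theta> \<rho>"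
      by (simp add: \<theta>_def integer_mod_group_def)
  qed
  interpret \<theta>: group_hom ?G ?C \<theta>
    by unfold_locales (rule \<theta>_hom)
  let ?K = "kernel ?G ?C \<theta>"
  have surj: "\<theta> ` carrier ?G = carrier ?C"
  proof
    show "\<theta> ` carrier ?G \<subseteq> carrier ?C"
      using \<theta>_hom by (auto simp: hom_def)
    \<comment> \<open>Exchanging 2i and 2i + 1 interchanges the two words of P, so it preserves Q;
      it shows that \<theta> attains 1.\<close>
    define swap where "swap j = (if j < 2 * n then if even j then j + 1 else j - 1 else j)" for j
    have "swap \<circ> swap = id"
      by (auto simp: swap_def fun_eq_iff elim!: evenE oddE)
    then have "swap permutes {..<2 * n}"
      by (intro permutes_if_inverse[where g = swap]) (simp_all add: swap_def)
    moreover have "Q (w \<circ> swap)" if "Q w" for w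
    proof -
      have "P (\<lambda>i. (w \<circ> swap) (2 * i))"
        using that P_cong[of "\<lambda>i. w (2 * i + 1)" "\<lambda>i. (w \<circ> swap) (2 * i)"]
        by (simp add: Q_iff swap_def)
      moreover have "P (\<lambda>i. (w \<circ> swap) (2 * i + 1))"
        using that P_cong[of "\<lambda>i. w (2 * i)" "\<lambda>i. (w \<circ> swap) (2 * i + 1)"]
        by (simp add: Q_iff swap_def)
      ultimately show ?thesis
        by (simp only: Q_iff)
    qed
    ultimately have "swap \<in> carrier ?G"
      by simp
    moreover have "\<theta> swap = 1"
      using \<open>n > 0\<close> by (simp add: \<theta>_def swap_def)
    moreover have "\<theta> id = 0"
      by (simp add: \<theta>_def)
    moreover have "carrier ?C = {0, 1}"
      by (auto simp: carrier_integer_mod_group)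
    ultimately show "carrier ?C \<subseteq> \<theta> ` carrier ?G"
      using G.one_closed by (auto simp: image_iff intro: permutes_id)
  qed
  have K_iff: "\<pi> \<in> ?K \<longleftrightarrow> \<pi> \<in> carrier ?G \<and> even (\<pi> 0)" for \<pi>
    by (auto simp: kernel_def \<theta>_def)
  \<comment> \<open>For e = 0 or 1, \<open>half e \<pi>\<close> is the action of a kernel element on
    the positions of parity e, renumbered from 0 to n - 1.\<close>
  define half :: "nat \<Rightarrow> (nat \<Rightarrow> nat) \<Rightarrow> nat \<Rightarrow> nat"
    where "half e \<pi> i = (if i < n then \<pi> (2 * i + e) div 2 else i)" for e \<pi> i
  have half_less: "half e \<pi> i < n" if "\<pi> \<in> ?K" "i < n" "e < 2" for e \<pi> i
    using less[of \<pi> "2 * i + e"] that by (auto simp: half_def K_iff)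
  have half_eq: "\<pi> (2 * i + e) = 2 * half e \<pi> i + e" if "\<pi> \<in> ?K" "i < n" "e < 2" for e \<pi> i
  proof -
    have "even (\<pi> (2 * i + e)) \<longleftrightarrow> even e"
      using parity[of \<pi> "2 * i + e"] that by (simp add: K_iff)
    then have "\<pi> (2 * i + e) mod 2 = e"
      using \<open>e < 2\<close> by (auto simp: less_2_cases_iff even_iff_mod_2_eq_zero odd_iff_mod_2_eq_one)
    then show ?thesis
      using that by (simp add: half_def) presburger
  qed
  have half_comp: "half e (\<pi> \<circ> \<rho>) = half e \<pi> \<circ> half e \<rho>" if "\<rho> \<in> ?K" "e < 2" for e \<pi> \<rho>
  proof
    fix i
    show "half e (\<pi> \<circ> \<rho>) i = (half e \<pi> \<circ> half e \<rho>) i"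
    proof (cases "i < n")
      case True
      have "half e (\<pi> \<circ> \<rho>) i = \<pi> (2 * half e \<rho> i + e) div 2"
        using True half_eq[OF that(1) True that(2)] by (simp add: half_def)
      also have "\<dots> = half e \<pi> (half e \<rho> i)"
        using half_less[OF that(1) True that(2)] by (simp add: half_def[of e \<pi>])
      finally show ?thesis
        by simp
    qed (simp add: half_def)
  qed
  have half_id: "half e id = id" if "e < 2" for e
    using that by (auto simp: half_def)
  have K_inv: "Hilbert_Choice.inv \<pi> \<in> ?K" if \<pi>: "\<pi> \<in> ?K" for \<pi>
  proof -
    have \<pi>G: "\<pi> \<in> carrier ?G" "even (\<pi> 0)"
      using \<pi> by (simp_all only: K_iff)
    have i: "Hilbert_Choice.inv \<pi> \<in> carrier ?G"
      by (rule inv_mem_word_aut) fact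
    have "even (\<pi> (Hilbert_Choice.inv \<pi> 0)) \<longleftrightarrow> (even (Hilbert_Choice.inv \<pi> 0) \<longleftrightarrow> even (\<pi> 0))"
      using \<open>n > 0\<close> by (intro parity \<pi>G less[OF i]) simp
    moreover have "\<pi> (Hilbert_Choice.inv \<pi> 0) = 0"
      using \<pi>G permutes_inverses(1)[of \<pi> "{..<2 * n}"] by simp
    ultimately show ?thesis
      using i \<pi>G by (simp add: K_iff)
  qed
  have half_mem: "half e \<pi> \<in> carrier ?A" if \<pi>: "\<pi> \<in> ?K" and e: "e < 2" for e \<pi>
  proof -
    have \<pi>G: "\<pi> permutes {..<2 * n}" "\<And>w. Q w \<Longrightarrow> Q (w \<circ> \<pi>)"
      using \<pi> by (simp_all add: K_iff)
    have "half e \<pi> \<circ> half e (Hilbert_Choice.inv \<pi>) = id"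
         "half e (Hilbert_Choice.inv \<pi>) \<circ> half e \<pi> = id"
      using half_comp[OF \<pi> e] half_comp[OF K_inv[OF \<pi>] e] half_id[OF e]
      by (simp_all only: permutes_inv_o[OF \<pi>G(1)] flip: half_comp[OF \<pi> e] half_comp[OF K_inv[OF \<pi>] e])
    then have "half e \<pi> permutes {..<n}"
      by (intro permutes_if_inverse) (simp_all add: half_def)
    moreover have "P (u \<circ> half e \<pi>)" if "P u" for u
    proof -
      \<comment> \<open>The word u is placed on the positions of parity e; reading the same class
        after \<pi> gives \<open>u \<circ> half e \<pi>\<close>.\<close>
      let ?w = "\<lambda>k. if k mod 2 = e then u (k div 2) else 0"
      have "Q ?w"
        using that P_zero e by (auto simp: Q_iff less_2_cases_iff)
      then have "Q (?w \<circ> \<pi>)"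
        by (rule \<pi>G)
      then have "P (\<lambda>i. (?w \<circ> \<pi>) (2 * i))" "P (\<lambda>i. (?w \<circ> \<pi>) (2 * i + 1))"
        by (simp_all only: Q_iff)
      moreover have "e = 0 \<or> e = 1"
        using e by auto
      ultimately have "P (\<lambda>i. (?w \<circ> \<pi>) (2 * i + e))"
        by (elim disjE) (simp_all only: add_0_right)
      then show ?thesis
      proof (rule P_cong)
        fix i assume "i < n"
        show "(?w \<circ> \<pi>) (2 * i + e) = (u \<circ> half e \<pi>) i"
          unfolding comp_apply half_eq[OF \<pi> \<open>i < n\<close> e] using e by simp
      qed
    qed
    ultimately show ?thesis
      by simp
  qed
  \<comment> \<open>No range check is made: \<sigma> and \<tau> fix all indices from n on, so the
    result fixes all indices from 2n on.\<close>
  define join :: "(nat \<Rightarrow> nat) \<Rightarrow> (nat \<Rightarrow> nat) \<Rightarrow> nat \<Rightarrow> nat"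
    where "join \<sigma> \<tau> j = (if even j then 2 * \<sigma> (j div 2) else 2 * \<tau> (j div 2) + 1)" for \<sigma> \<tau> j
  have join_mem: "join \<sigma> \<tau> \<in> ?K" if \<sigma>: "\<sigma> \<in> carrier ?A" and \<tau>: "\<tau> \<in> carrier ?A" for \<sigma> \<tau>
  proof -
    have perm: "\<sigma> permutes {..<n}" "\<tau> permutes {..<n}"
      using \<sigma> \<tau> by simp_all
    have "join \<sigma> \<tau> permutes {..<2 * n}"
    proof (rule permutes_if_inverse)
      let ?i = "join (Hilbert_Choice.inv \<sigma>) (Hilbert_Choice.inv \<tau>)"
      show "join \<sigma> \<tau> \<circ> ?i = id" "?i \<circ> join \<sigma> \<tau> = id"
        by (auto simp: fun_eq_iff join_def permutes_inverses[OF perm(1)] permutes_inverses[OF perm(2)])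
      show "join \<sigma> \<tau> j = j" if "j \<notin> {..<2 * n}" for j
        using permutes_not_in[OF perm(1), of "j div 2"] permutes_not_in[OF perm(2), of "j div 2"] that
        by (auto simp: join_def)
    qed
    moreover have "Q (w \<circ> join \<sigma> \<tau>)" if "Q w" for w
    proof -
      have "P ((\<lambda>i. w (2 * i)) \<circ> \<sigma>)" "P ((\<lambda>i. w (2 * i + 1)) \<circ> \<tau>)"
        using that \<sigma> \<tau> by (simp_all only: Q_iff word_aut_simps)
      then show ?thesis
        by (simp add: Q_iff join_def comp_def)
    qed
    ultimately show ?thesis
      by (simp add: K_iff join_def)
  qed
  have half_join: "half 0 (join \<sigma> \<tau>) = \<sigma>" "half 1 (join \<sigma> \<tau>) = \<tau>"
    if \<sigma>: "\<sigma> \<in> carrier ?A" and \<tau>: "\<tau> \<in> carrier ?A" for \<sigma> \<tau>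
    using \<sigma> \<tau> permutes_not_in[of \<sigma> "{..<n}"] permutes_not_in[of \<tau> "{..<n}"]
    by (auto simp: fun_eq_iff half_def join_def)
  have join_half: "join (half 0 \<pi>) (half 1 \<pi>) = \<pi>" if \<pi>: "\<pi> \<in> ?K" for \<pi>
  proof
    fix j
    have perm: "\<pi> permutes {..<2 * n}"
      using \<pi> by (simp add: K_iff)
    show "join (half 0 \<pi>) (half 1 \<pi>) j = \<pi> j"
    proof (cases "j < 2 * n")
      case True
      then show ?thesis
        using half_eq[OF \<pi>, of "j div 2" 0] half_eq[OF \<pi>, of "j div 2" 1]
        by (auto simp: join_def elim!: evenE oddE)
    next
      case False
      then show ?thesis
        using permutes_not_in[OF perm, of j] by (auto simp: join_def half_def)
    qed
  qed
  let ?\<psi> = "\<lambda>\<pi>. (half 0 \<pi>, half 1 \<pi>)"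
  have "?\<psi> \<in> iso (?G\<lparr>carrier := ?K\<rparr>) (?A \<times>\<times> ?A)"
  proof (rule isoI)
    show "?\<psi> \<in> hom (?G\<lparr>carrier := ?K\<rparr>) (?A \<times>\<times> ?A)"
    proof (rule homI)
      fix \<pi> assume "\<pi> \<in> carrier (?G\<lparr>carrier := ?K\<rparr>)"
      then show "?\<psi> \<pi> \<in> carrier (?A \<times>\<times> ?A)"
        using half_mem[of \<pi> 0] half_mem[of \<pi> 1] by (simp add: DirProd_def)
    next
      fix \<pi> \<rho> assume "\<pi> \<in> carrier (?G\<lparr>carrier := ?K\<rparr>)" "\<rho> \<in> carrier (?G\<lparr>carrier := ?K\<rparr>)"
      then show "?\<psi> (\<pi> \<otimes>\<^bsub>?G\<lparr>carrier := ?K\<rparr>\<^esub> \<rho>) = ?\<psi> \<pi> \<otimes>\<^bsub>?A \<times>\<times> ?A\<^esub> ?\<psi> \<rho>"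
        using half_comp[of \<rho> 0 \<pi>] half_comp[of \<rho> 1 \<pi>] by simp
    qed
    show "bij_betw ?\<psi> (carrier (?G\<lparr>carrier := ?K\<rparr>)) (carrier (?A \<times>\<times> ?A))"
    proof (rule bij_betwI[where g = "\<lambda>(\<sigma>, \<tau>). join \<sigma> \<tau>"])
      show "?\<psi> \<in> carrier (?G\<lparr>carrier := ?K\<rparr>) \<rightarrow> carrier (?A \<times>\<times> ?A)"
        using half_mem[of _ 0] half_mem[of _ 1] by (auto simp: DirProd_def simp del: word_aut_simps(3))
      show "(\<lambda>(\<sigma>, \<tau>). join \<sigma> \<tau>) \<in> carrier (?A \<times>\<times> ?A) \<rightarrow> carrier (?G\<lparr>carrier := ?K\<rparr>)"
        using join_mem by (auto simp: DirProd_def simp del: word_aut_simps(3))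
    qed (auto simp: DirProd_def half_join[simplified] join_half[simplified])
  qed
  then have "?G\<lparr>carrier := ?K\<rparr> \<cong> ?A \<times>\<times> ?A"
    by (rule is_isoI)
  then show ?thesis
    unfolding is_extension_def using \<theta>.normal_kernel \<theta>.FactGroup_iso[OF surj] by blast
qed

section \<open>Divisibility of binary polynomials\<close>

lemma bit_poly_add_self [simp]: "a + a = 0" for a :: "bit poly"
proof -
  have "a + a = smult (1 + 1) a"
    by (simp only: smult_add_left smult_1_left)
  then show ?thesis
    by simp
qed

lemma bit_poly_two_eq_0 [simp]: "2 = (0 :: bit poly)"
  using bit_poly_add_self[of 1] by (simp only: one_add_one)

lemma bit_poly_minus_eq_plus: "a - b = a + b" for a b :: "bit poly"
  by (rule poly_eqI) simp

lemma bit_poly_square_add: "(a + b)\<^sup>2 = a\<^sup>2 + b\<^sup>2" for a b :: "bit poly"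
proof -
  have "(a + b)\<^sup>2 = a\<^sup>2 + b\<^sup>2 + (a * b + a * b)"
    by (simp only: power2_eq_square distrib_left distrib_right ac_simps)
  then show ?thesis
    by simp
qed

text \<open>Squaring is additive here; this is the origin of the multiplicity two of the factors of
  x^(2p) - 1.\<close>

lemma square_monom_minus_one: "(monom 1 n - 1)\<^sup>2 = (monom 1 (2 * n) - 1 :: bit poly)"
  by (simp add: bit_poly_minus_eq_plus bit_poly_square_add monom_power mult.commute)

section \<open>Polynomials of words and their decompositions\<close>

lemma word_poly_Suc: "word_poly (Suc n) w = word_poly n w + monom (w n) n"
  by (simp add: word_poly_def)

lemma word_poly_add: "word_poly n (\<lambda>i. u i + v i) = word_poly n u + word_poly n v"
  unfolding word_poly_def add_monom[symmetric] by (rule sum.distrib)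

lemma word_poly_zero: "word_poly n (\<lambda>_. 0) = 0"
  by (simp add: word_poly_def)

lemma word_poly_unit: "i < n \<Longrightarrow> word_poly n (\<lambda>k. of_bool (k = i)) = monom 1 i"
proof (induction n)
  case (Suc n)
  have "word_poly i (\<lambda>k. of_bool (k = i)) = word_poly i (\<lambda>_. 0)"
    by (rule word_poly_cong) simp
  then show ?case
    using Suc by (cases "i = n") (simp_all add: word_poly_Suc word_poly_zero)
qed simp

lemma word_poly_concat:
  "word_poly (n + m) w = word_poly n w + monom 1 n * word_poly m (\<lambda>i. w (i + n))"
proof (induction m)
  case (Suc m)
  then show ?case
    by (simp add: word_poly_Suc distrib_left mult_monom add.commute add.left_commute)
qed (simp add: word_poly_def)

text \<open>Writing x^n as 1 + (x^n - 1) folds the second half onto the first; a divisor of x^n - 1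
  sees only the folded word.\<close>

lemma word_poly_double:
  "word_poly (2 * n) w =
    word_poly n (\<lambda>i. w i + w (i + n)) + (monom 1 n - 1) * word_poly n (\<lambda>i. w (i + n))"
  unfolding mult_2 word_poly_concat word_poly_add left_diff_distrib by simp

text \<open>Squaring is additive and fixes the coefficients 0 and 1, so it just doubles exponents;
  the two squares collect the even and the odd positions.\<close>

lemma word_poly_interleave:
  "word_poly (2 * n) w =
    (word_poly n (\<lambda>i. w (2 * i)))\<^sup>2 + monom 1 1 * (word_poly n (\<lambda>i. w (2 * i + 1)))\<^sup>2"
proof (induction n)
  case (Suc n)
  have "word_poly (2 * Suc n) w =
      word_poly (2 * n) w + monom (w (2 * n)) (2 * n) + monom (w (2 * n + 1)) (2 * n + 1)"
    by (simp add: word_poly_Suc)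
  moreover have "a\<^sup>2 = a" for a :: bit
    by (cases a) simp_all
  ultimately show ?case
    unfolding Suc.IH
    by (simp add: word_poly_Suc bit_poly_square_add monom_power distrib_left mult_monom mult.commute)
qed (simp add: word_poly_def)

text \<open>Squares have derivative zero, so A^2 + x B^2 has derivative B^2, whereas g^2 q has
  derivative g^2 q'. This gives divisibility of B first, and that of A by subtraction.\<close>

lemma square_dvd_interleave_iff:
  fixes g A B :: "bit poly"
  assumes "prime_elem g"
  shows "g\<^sup>2 dvd A\<^sup>2 + monom 1 1 * B\<^sup>2 \<longleftrightarrow> g dvd A \<and> g dvd B"
proof
  assume dvd: "g\<^sup>2 dvd A\<^sup>2 + monom 1 1 * B\<^sup>2"
  have pderiv_square: "pderiv (a\<^sup>2) = 0" for a :: "bit poly"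
    by (simp add: power2_eq_square pderiv_mult mult.commute)
  from dvd obtain q where "A\<^sup>2 + monom 1 1 * B\<^sup>2 = g\<^sup>2 * q" ..
  then have "pderiv (A\<^sup>2 + monom 1 1 * B\<^sup>2) = g\<^sup>2 * pderiv q"
    by (simp add: pderiv_mult pderiv_square)
  moreover have "pderiv (A\<^sup>2 + monom 1 1 * B\<^sup>2) = B\<^sup>2"
    by (simp add: pderiv_add pderiv_mult pderiv_square pderiv_monom)
  ultimately have "B\<^sup>2 = g * (g * pderiv q)"
    by (simp only: power2_eq_square mult.assoc)
  then have "g dvd B\<^sup>2"
    by (rule dvdI)
  then have B: "g dvd B"
    using assms prime_elem_dvd_power by blast
  then have "g\<^sup>2 dvd monom 1 1 * B\<^sup>2"
    by (simp add: dvd_power_same)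
  then have "g\<^sup>2 dvd A\<^sup>2"
    using dvd by (simp add: dvd_add_left_iff)
  then have "g dvd A\<^sup>2"
    by (simp add: power2_eq_square dvd_mult_left)
  then show "g dvd A \<and> g dvd B"
    using B assms prime_elem_dvd_power by blast
qed (simp add: dvd_power_same)

section \<open>Powers of x modulo an irreducible factor of x^p - 1\<close>

lemma not_dvd_monom:
  fixes g :: "bit poly"
  assumes "prime_elem g" and "g dvd monom 1 p - 1" and "p > 0"
  shows "\<not> g dvd monom 1 i"
proof
  assume "g dvd monom 1 i"
  then have "g dvd [:0, 1:] ^ i"
    by (simp add: monom_altdef)
  then have "g dvd [:0, 1:]"
    using assms(1) prime_elem_dvd_power by blast
  \<comment> \<open>Here x vanishes modulo g, which contradicts x^p = 1 modulo g.\<close>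
  then have "g dvd [:0, 1:] ^ p"
    using \<open>p > 0\<close> by (meson dvd_power dvd_trans)
  then have "g dvd monom 1 p"
    by (simp add: monom_altdef)
  then have "g dvd 1"
    using assms(2) by (metis add_diff_cancel_left' diff_diff_eq2 dvd_diff)
  then show False
    using assms(1) prime_elem_not_unit by blast
qed

lemma monom_minus_one_dvd: "monom 1 a - 1 dvd (monom 1 (a * b) - 1 :: bit poly)"
proof -
  have "monom 1 (a * b) - 1 = (monom 1 a :: bit poly) ^ b - 1"
    by (simp add: monom_power)
  then show ?thesis
    by (simp add: power_diff_1_eq)
qed

text \<open>Removing the factor x^i leaves x^d = 1 modulo f with 0 < d < p. As d is prime to p and
  x^p = 1 as well, x = 1 modulo f, which forces f = x + 1.\<close>

lemma not_dvd_monom_add_monom: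
  fixes f :: "bit poly"
  assumes "prime p" and "irreducible f" and "f dvd monom 1 p - 1" and "f \<noteq> [:1, 1:]"
    and "i < j" and "j < p"
  shows "\<not> f dvd monom 1 i + monom 1 j"
proof
  have f: "prime_elem f"
    using assms(2) by (rule field_poly_irreducible_imp_prime)
  define d where "d = j - i"
  have d: "0 < d" "d < p" "j = i + d"
    using assms(5,6) by (auto simp: d_def)
  assume "f dvd monom 1 i + monom 1 j"
  also have "monom 1 i + monom 1 j = monom 1 i * (monom 1 d - 1 :: bit poly)"
    by (simp add: d bit_poly_minus_eq_plus distrib_left mult_monom)
  finally have "f dvd monom 1 d - 1"
    using not_dvd_monom[OF f assms(3)] d prime_elem_dvd_multD[OF f] by (metis gr_implies_not0 not_gr_zero)
  have "coprime p d"
    using prime_imp_coprime[OF \<open>prime p\<close>] nat_dvd_not_less[OF d(1,2)] by blast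
  then obtain x y where xy: "d * x = p * y + 1"
    using d(1) coprime_bezout_strong[of d p] prime_gt_1_nat[OF \<open>prime p\<close>] by (auto simp: coprime_commute)
  have "f dvd monom 1 (d * x) - 1" "f dvd monom 1 (p * y) - 1"
    using \<open>f dvd monom 1 d - 1\<close> assms(3) monom_minus_one_dvd dvd_trans by blast+
  \<comment> \<open>The Bezout relation leads to the exponent 1: with X the indeterminate, this
    combination telescopes to X - 1 = X + 1.\<close>
  then have "f dvd (monom 1 (p * y + 1) - 1) - monom 1 1 * (monom 1 (p * y) - 1)"
    unfolding xy by (intro dvd_diff[OF _ dvd_mult])
  also have "(monom 1 (p * y + 1) - 1) - monom 1 1 * (monom 1 (p * y) - 1) = ([:1, 1:] :: bit poly)"
    by (simp add: right_diff_distrib mult_monom) (simp add: monom_altdef bit_poly_minus_eq_plus one_pCons)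
  finally obtain q where q: "[:1, 1:] = f * q" ..
  have "irreducible [:1, 1 :: bit:]"
    by (rule irreducible_linear_field_poly) simp
  then have "is_unit q"
    using irreducibleD[OF _ q] assms(2) by (auto simp: irreducible_def)
  then obtain c where "q = [:c:]" "c dvd 1"
    by (auto simp: is_unit_poly_iff)
  \<comment> \<open>The only nonzero constant is 1, so the associates f and X + 1 would be
    equal.\<close>
  then show False
    using q assms(4) by (cases c) simp_all
qed

text \<open>Multiplying the shifted word by x gives back the word up to a multiple of x^p - 1, hence
  of g, and the prime g does not divide x.\<close>

lemma shift_mem_word_aut:
  assumes g: "prime_elem g" "g dvd monom 1 p - 1" and "p > 0"
  shows "(\<lambda>i. if i < p then Suc i mod p else i) \<in> carrier (word_aut p (\<lambda>w. g dvd word_poly p w))"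
    (is "?s \<in> _")
proof -
  obtain m where m: "p = Suc m"
    using \<open>p > 0\<close> by (cases p) auto
  let ?r = "\<lambda>i. if i < p then (if i = 0 then m else i - 1) else i"
  have "?s permutes {..<p}"
  proof (rule permutes_if_inverse[where g = ?r])
    show "?s \<circ> ?r = id" "?r \<circ> ?s = id"
      by (auto simp: fun_eq_iff m mod_Suc)
  qed simp
  moreover have "g dvd word_poly p (w \<circ> ?s)" if w: "g dvd word_poly p w" for w
  proof -
    have "word_poly m (w \<circ> ?s) = word_poly m (\<lambda>i. w (i + 1))"
      by (rule word_poly_cong) (simp add: m)
    then have "monom 1 1 * word_poly p (w \<circ> ?s) =
        monom 1 1 * word_poly m (\<lambda>i. w (i + 1)) + monom (w 0) p"
      by (simp add: m word_poly_Suc distrib_left mult_monom)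
    also have "\<dots> = word_poly p w + monom (w 0) 0 * (monom 1 p - 1)"
      using word_poly_concat[of 1 m w]
      by (simp add: m word_poly_Suc[of 0] bit_poly_minus_eq_plus distrib_left mult_monom word_poly_def[of 0])
    finally have "g dvd monom 1 1 * word_poly p (w \<circ> ?s)"
      using w g(2) by simp
    then show ?thesis
      using prime_elem_dvd_multD[OF g(1)] not_dvd_monom[OF g \<open>p > 0\<close>] by blast
  qed
  ultimately show ?thesis
    by simp
qed

text \<open>The prime g divides x - 1 or 1 + x + ... + x^(p-1), and either factor is itself the
  polynomial of a word with a one at position 0.\<close>

lemma ex_word_nonzero:
  fixes g :: "bit poly"
  assumes g: "prime_elem g" "g dvd monom 1 p - 1" and "p > 1"
  shows "\<exists>w. g dvd word_poly p w \<and> w 0 = 1"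
proof -
  have "monom 1 p - 1 = (monom 1 1 - 1) * (\<Sum>i<p. (monom 1 1 :: bit poly) ^ i)"
    using power_diff_1_eq[of "monom 1 1 :: bit poly" p] by (simp add: monom_power)
  also have "(\<Sum>i<p. (monom 1 1 :: bit poly) ^ i) = word_poly p (\<lambda>_. 1)"
    by (simp add: word_poly_def monom_power)
  finally consider "g dvd monom 1 1 - 1" | "g dvd word_poly p (\<lambda>_. 1)"
    using g prime_elem_dvd_multD by metis
  then show ?thesis
  proof cases
    case 1
    have "word_poly p (\<lambda>k. of_bool (k = 1) + of_bool (k = 0)) = monom 1 1 + monom 1 0"
      unfolding word_poly_add using \<open>p > 1\<close> by (simp add: word_poly_unit)
    also have "\<dots> = monom 1 1 - 1"
      by (simp add: bit_poly_minus_eq_plus)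
    finally show ?thesis
      using 1 by (intro exI[of _ "\<lambda>k. of_bool (k = 1) + of_bool (k = 0)"]) simp
  qed auto
qed

text \<open>Divisibility by x + 1 means vanishing at 1, that is, entry sum zero, which every
  permutation preserves. The isomorphism merely renumbers positions, since
  \<open>sym_group N\<close> permutes \<open>{1..N}\<close>.\<close>

lemma word_aut_parity_iso_sym_group:
  "word_aut N (\<lambda>w. [:1, 1:] dvd word_poly N w) \<cong> sym_group N" (is "?G \<cong> _")
proof -
  have dvd_iff: "[:1, 1:] dvd word_poly N w \<longleftrightarrow> (\<Sum>i<N. w i) = 0" for w
  proof -
    have "poly (word_poly N w) 1 = (\<Sum>i<N. w i)"
      by (simp only: word_poly_def poly_sum poly_monom power_one mult_1_right)
    moreover have "- 1 = (1 :: bit)"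
      by simp
    ultimately show ?thesis
      using poly_eq_0_iff_dvd[of "word_poly N w" 1] by (simp only:)
  qed
  have mem: "\<pi> \<in> carrier ?G \<longleftrightarrow> \<pi> permutes {..<N}" for \<pi>
    using sum.permute[of \<pi> "{..<N}"] unfolding word_aut_simps dvd_iff by metis
  define up :: "(nat \<Rightarrow> nat) \<Rightarrow> nat \<Rightarrow> nat" where "up \<pi> i = (if i = 0 then 0 else Suc (\<pi> (i - 1)))" for \<pi> i
  define down :: "(nat \<Rightarrow> nat) \<Rightarrow> nat \<Rightarrow> nat" where "down \<rho> i = \<rho> (Suc i) - 1" for \<rho> i
  have up_comp: "up (\<pi> \<circ> \<rho>) = up \<pi> \<circ> up \<rho>" for \<pi> \<rho>
    by (auto simp: up_def)
  have up_id: "up id = id"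
    by (auto simp: up_def)
  have up: "up \<pi> permutes {1..N}" if \<pi>: "\<pi> permutes {..<N}" for \<pi>
  proof (rule permutes_if_inverse[where g = "up (Hilbert_Choice.inv \<pi>)"])
    show "up \<pi> \<circ> up (Hilbert_Choice.inv \<pi>) = id" "up (Hilbert_Choice.inv \<pi>) \<circ> up \<pi> = id"
      by (simp_all only: up_comp[symmetric] permutes_inv_o[OF \<pi>] up_id)
    show "up \<pi> i = i" if "i \<notin> {1..N}" for i
      using that permutes_not_in[OF \<pi>, of "i - 1"] by (auto simp: up_def)
  qed
  \<comment> \<open>As \<rho> fixes 0 and is injective, the truncated subtraction in
    \<open>down\<close> loses nothing.\<close>
  have pos: "0 < \<rho> (Suc i)" if "\<rho> permutes {1..N}" for \<rho> :: "nat \<Rightarrow> nat" and i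
    using that permutes_not_in[OF that, of 0] permutes_inj[OF that] by (metis atLeastAtMost_iff gr0I inj_eq nat.distinct(1) not_one_le_zero)
  have down_comp: "down (\<rho> \<circ> \<sigma>) = down \<rho> \<circ> down \<sigma>" if "\<sigma> permutes {1..N}" for \<rho> \<sigma>
    using pos[OF that] by (auto simp: down_def fun_eq_iff)
  have down_id: "down id = id"
    by (auto simp: down_def)
  have down: "down \<rho> permutes {..<N}" if \<rho>: "\<rho> permutes {1..N}" for \<rho>
  proof (rule permutes_if_inverse[where g = "down (Hilbert_Choice.inv \<rho>)"])
    show "down \<rho> \<circ> down (Hilbert_Choice.inv \<rho>) = id" "down (Hilbert_Choice.inv \<rho>) \<circ> down \<rho> = id"
      by (simp_all only: down_comp[OF permutes_inv[OF \<rho>], symmetric] down_comp[OF \<rho>, symmetric]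
          permutes_inv_o[OF \<rho>] down_id)
    show "down \<rho> i = i" if "i \<notin> {..<N}" for i
      using that permutes_not_in[OF \<rho>, of "Suc i"] by (auto simp: down_def)
  qed
  have "up \<in> iso ?G (sym_group N)"
  proof (rule isoI)
    show "up \<in> hom ?G (sym_group N)"
      using up by (auto simp: hom_def mem up_comp sym_group_def simp del: word_aut_simps(3))
    show "bij_betw up (carrier ?G) (carrier (sym_group N))"
    proof (rule bij_betwI[where g = down])
      show "up (down \<rho>) = \<rho>" if "\<rho> \<in> carrier (sym_group N)" for \<rho>
      proof
        fix i
        show "up (down \<rho>) i = \<rho> i"
          using that pos[of \<rho> "i - 1"] permutes_not_in[of \<rho> "{1..N}" 0]
          by (cases i) (simp_all add: up_def down_def sym_group_def)
      qed
      show "down (up \<pi>) = \<pi>" for \<pi>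
        by (auto simp: up_def down_def)
    qed (use up down in \<open>auto simp: mem sym_group_def simp del: word_aut_simps(3)\<close>)
  qed
  then show ?thesis
    by (rule is_isoI)
qed

section \<open>The automorphism groups in the three cases for f\<close>

theorem theorem4p2:
  fixes p :: nat and f g :: "bit poly"
  assumes "prime p" and "p > 2"
    and "irreducible g" and "g dvd monom 1 (2 * p) - 1"
    and "f = g \<or> f = g\<^sup>2"
  shows "(f = [:1, 1:] \<longrightarrow>
            code_aut (2 * p) (cyclic_code (2 * p) f) \<cong> sym_group (2 * p)) \<and>
         (irreducible f \<and> f \<noteq> [:1, 1:] \<longrightarrow>
            is_split_extension (code_aut (2 * p) (cyclic_code (2 * p) f))
              (product_group {..<p} (\<lambda>_. sym_group 2))
              (code_aut p (cyclic_code p f))) \<and>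
         (f = g\<^sup>2 \<longrightarrow>
            is_extension (code_aut (2 * p) (cyclic_code (2 * p) f))
              (code_aut p (cyclic_code p g) \<times>\<times> code_aut p (cyclic_code p g))
              (integer_mod_group 2))"
proof -
  have g: "prime_elem g"
    using assms(3) by (rule field_poly_irreducible_imp_prime)
  \<comment> \<open>x^(2p) - 1 is the square of x^p - 1, and a prime dividing a square divides its
    base.\<close>
  then have gp: "g dvd monom 1 p - 1"
    using assms(4) by (metis square_monom_minus_one prime_elem_dvd_power)
  then have "g\<^sup>2 dvd monom 1 (2 * p) - 1"
    unfolding square_monom_minus_one[symmetric] by (rule dvd_power_same)
  then have f2p: "f dvd monom 1 (2 * p) - 1"
    using assms(4,5) by blast
  have p: "p > 0" "p > 1"
    using assms(2) by simp_all
  have "is_split_extension (code_aut (2 * p) (cyclic_code (2 * p) f))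
      (product_group {..<p} (\<lambda>_. sym_group 2)) (code_aut p (cyclic_code p f))"
    if f: "irreducible f" "f \<noteq> [:1, 1:]"
  proof -
    \<comment> \<open>The square of a nonunit is reducible, which excludes f = g^2.\<close>
    have "f = g"
    proof (rule ccontr)
      assume "f \<noteq> g"
      then have "f = g * g"
        using assms(5) by (simp add: power2_eq_square)
      then show False
        using irreducibleD[OF f(1)] assms(3) by (auto simp: irreducible_def)
    qed
    then have fp: "f dvd monom 1 p - 1"
      using gp by simp
    show ?thesis
      unfolding code_aut_cyclic_code[OF f2p] code_aut_cyclic_code[OF fp]
    proof (rule word_aut_split_extension)
      show "f dvd word_poly p v" if "f dvd word_poly p u" "\<And>i. i < p \<Longrightarrow> u i = v i" for u v
        using that word_poly_cong by metis
      show "f dvd word_poly (2 * p) w \<longleftrightarrow> f dvd word_poly p (\<lambda>i. w i + w (i + p))" for w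
        unfolding word_poly_double using fp by (simp add: dvd_add_left_iff)
      show "f dvd word_poly p (\<lambda>_. 0)"
        by (simp add: word_poly_zero)
      show "i = j" if "i < p" "j < p" "f dvd word_poly p (\<lambda>k. of_bool (k = i) + of_bool (k = j))" for i j
      proof (rule ccontr)
        assume "i \<noteq> j"
        have "f dvd monom 1 i + monom 1 j"
          using that unfolding word_poly_add by (simp add: word_poly_unit)
        then show False
          using not_dvd_monom_add_monom[OF assms(1) f(1) fp f(2)] that \<open>i \<noteq> j\<close>
          by (metis add.commute linorder_less_linear)
      qed
    qed
  qed
  moreover have "is_extension (code_aut (2 * p) (cyclic_code (2 * p) f))
      (code_aut p (cyclic_code p g) \<times>\<times> code_aut p (cyclic_code p g)) (integer_mod_group 2)"
    if f: "f = g\<^sup>2"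
    unfolding code_aut_cyclic_code[OF f2p] code_aut_cyclic_code[OF gp]
  proof (rule word_aut_extension)
    show cong: "g dvd word_poly p v" if "g dvd word_poly p u" "\<And>i. i < p \<Longrightarrow> u i = v i" for u v
      using that word_poly_cong by metis
    show "f dvd word_poly (2 * p) w \<longleftrightarrow>
        g dvd word_poly p (\<lambda>i. w (2 * i)) \<and> g dvd word_poly p (\<lambda>i. w (2 * i + 1))" for w
      unfolding f word_poly_interleave by (rule square_dvd_interleave_iff[OF g])
    show "g dvd word_poly p (\<lambda>_. 0)"
      by (simp add: word_poly_zero)
    \<comment> \<open>The one at position 0 makes 0 the value of \<open>j0\<close> in
      \<open>separator_cyclic_prime\<close>.\<close>
    obtain w0 where w0: "g dvd word_poly p w0" "w0 0 = 1"
      using ex_word_nonzero[OF g gp p(2)] by blast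
    show "S = {..<p}" if "separator p (\<lambda>w. g dvd word_poly p w) S" "S \<noteq> {}" for S
      using assms(1) shift_mem_word_aut[OF g gp p(1)] cong w0(1) p(1) w0(2) _ that
    proof (rule separator_cyclic_prime)
      show "\<not> g dvd word_poly p (\<lambda>k. of_bool (k = i))" if "i < p" for i
        using not_dvd_monom[OF g gp p(1)] that by (simp add: word_poly_unit)
    qed
  qed (rule p(1))
  moreover have "code_aut (2 * p) (cyclic_code (2 * p) f) \<cong> sym_group (2 * p)" if "f = [:1, 1:]"
    using code_aut_cyclic_code[OF f2p] word_aut_parity_iso_sym_group[of "2 * p"]
    unfolding that by (simp only:)
  ultimately show ?thesis
    by blast
qed

end
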